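(* Let $w$ be a real-valued locally semiconvex function on an open set $X\subset\mathbb{R}^n$ with strict upper contact jet $(p,A)\in\mathbb{R}^n\times\mathcal{S}(n)$ at $x\in X$. Then there exists $\bar\rho>0$ such that $$\bigl|\mathcal{C}^+(w,\overline{B}_\rho(x),A)\bigr|>0\qquad\forall\,\rho\in(0,\bar\rho\,],$$ where $|\cdot|$ denotes Lebesgue measure.
   Context: $\mathcal{S}(n)$ is the space of real symmetric $n\times n$ matrices. A function $w$ is $\lambda$-semiconvex ($\lambda\ge0$) on a convex set if $w+\frac{\lambda}{2}|\cdot|^2$ is convex there; $w$ is locally semiconvex on $X$ if every $x\in X$ belongs to some ball $B\subset X$ on which $w$ is $\lambda$-semiconvex for some $\lambda=\lambda(x)\ge0$. $(p,A)$ is a strict upper contact jet for $w$ at $x$ if $w(y)<w(x)+\langle p,y-x\rangle+\frac12\langle A(y-x),y-x\rangle$ for all $y\neq x$ in $X$ near $x$. For a set $K\subset X$, $\mathcal{C}^+(w,K,A)$ is the set of global upper contact points of type $A$ for $w$ on $K$: $$\mathcal{C}^+(w,K,A)=\bigl\{z\in K:\ \exists\,q\in\mathbb{R}^n\text{ such that } w(y)\leq w(z)+\langle q,y-z\rangle+\tfrac12\langle A(y-z),y-z\rangle\ \ \forall\,y\in K\bigr\}.$$ $\overline{B}_\rho(x)$ is the closed ball of radius $\rho$ and center $x$. *)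

theory Defs
  imports "HOL-Analysis.Analysis"
begin

definition sym_matrices :: "(real ^ 'n ^ 'n) set" where
  "sym_matrices = {A. transpose A = A}"

text \<open>Convexity of the set \<open>S\<close> is part of the library notion \<^const>\<open>convex_on\<close>.\<close>

definition semiconvex_on :: "real \<Rightarrow> (real ^ 'n) set \<Rightarrow> (real ^ 'n \<Rightarrow> real) \<Rightarrow> bool" where
  "semiconvex_on l S w \<longleftrightarrow> 0 \<le> l \<and> convex_on S (\<lambda>y. w y + l / 2 * (norm y)\<^sup>2)"

text \<open>The ball around a point of \<open>X\<close> is open and need not be centred at that point.\<close>

definition locally_semiconvex_on :: "(real ^ 'n) set \<Rightarrow> (real ^ 'n \<Rightarrow> real) \<Rightarrow> bool" where
  "locally_semiconvex_on X w \<longleftrightarrow>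
     (\<forall>x\<in>X. \<exists>c r. x \<in> ball c r \<and> ball c r \<subseteq> X \<and> (\<exists>l\<ge>0. semiconvex_on l (ball c r) w))"

text \<open>
  The filter \<open>at x within X\<close> omits the point \<open>x\<close> itself, so the strict inequality is required
  at all \<open>y \<noteq> x\<close> in \<open>X\<close> near \<open>x\<close>.
\<close>

definition strict_upper_contact_jet ::
  "(real ^ 'n) set \<Rightarrow> (real ^ 'n \<Rightarrow> real) \<Rightarrow> real ^ 'n \<Rightarrow> real ^ 'n \<Rightarrow> real ^ 'n ^ 'n \<Rightarrow> bool" where
  "strict_upper_contact_jet X w x p A \<longleftrightarrow>
     (\<forall>\<^sub>F y in at x within X. w y < w x + p \<bullet> (y - x) + 1 / 2 * ((A *v (y - x)) \<bullet> (y - x)))"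

definition upper_contact_points ::
  "(real ^ 'n \<Rightarrow> real) \<Rightarrow> (real ^ 'n) set \<Rightarrow> real ^ 'n ^ 'n \<Rightarrow> (real ^ 'n) set" where
  "upper_contact_points w K A =
     {z \<in> K. \<exists>q. \<forall>y\<in>K. w y \<le> w z + q \<bullet> (y - z) + 1 / 2 * ((A *v (y - z)) \<bullet> (y - z))}"

end

theory Submission
  imports Defs
begin

text \<open>
  This is Jensen's lemma, proved by comparing the contact set with the set of slopes it realises.

  Subtracting the quadratic form of \<open>A\<close> reduces everything to contact with affine functions: put
  \<open>g y = w y - \<langle>A y, y\<rangle> / 2\<close>. Type-\<open>A\<close> contact of \<open>w\<close> at \<open>z\<close> is then the same as \<open>g\<close> lying below an
  affine function that touches it at \<open>z\<close> (\<open>upper_contact_points_eq_tangent_points\<close>), and the strict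
  contact jet says that \<open>g\<close> lies strictly below an affine function of some slope \<open>p'\<close> away from \<open>x\<close>.

  On the sphere bounding the ball the strict inequality has a uniform margin. Tilting the affine
  function slightly therefore still produces a contact point inside the open ball, so every slope in
  some ball around \<open>p'\<close> is realised at an interior point (\<open>nearby_slopes_touch_inside\<close>). Conversely,
  \<open>g\<close> lies below its touching affine functions and, being semiconvex, lies above them minus a
  multiple of the squared distance; the two bounds together make the slope a single-valued and locally
  Lipschitz function of the interior contact point (\<open>slope_difference_bound\<close>). Lipschitz maps send
  null sets to null sets, but a ball is not null; so the contact set is not null
  (\<open>tangent_points_not_negligible\<close>). It is a Borel set (\<open>tangent_points_borel\<close>), so its Lebesgue
  measure is positive.
\<close>

section \<open>Affine functions touching from above\<close>

definition touching_slope :: "('a::euclidean_space \<Rightarrow> real) \<Rightarrow> 'a set \<Rightarrow> 'a \<Rightarrow> 'a \<Rightarrow> bool" where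
  "touching_slope g K z q \<longleftrightarrow> (\<forall>y\<in>K. g y \<le> g z + q \<bullet> (y - z))"

definition tangent_points :: "('a::euclidean_space \<Rightarrow> real) \<Rightarrow> 'a set \<Rightarrow> 'a set" where
  "tangent_points g K = {z \<in> K. \<exists>q. touching_slope g K z q}"

text \<open>
  Measurability matters because \<^const>\<open>emeasure\<close> is zero by convention on non-measurable sets. The
  tangent points need not form a closed set, since slopes may blow up at the boundary of \<open>K\<close>; but
  those with a slope of norm at most \<open>m\<close> form a compact set, a projection of a compact set of pairs
  (point, slope).
\<close>

lemma tangent_points_borel:
  fixes g :: "'a::euclidean_space \<Rightarrow> real"
  assumes K: "compact K" and g: "continuous_on K g"
  shows "tangent_points g K \<in> sets borel"
proof -
  define P where "P m = {zq \<in> K \<times> cball 0 (real m). touching_slope g K (fst zq) (snd zq)}" for m :: nat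
  have "compact (P m)" for m
  proof -
    have KC: "compact (K \<times> cball (0::'a) (real m))"
      using K by (intro compact_Times) auto
    have cont: "continuous_on (K \<times> cball (0::'a) (real m)) (\<lambda>zq. g (fst zq) + snd zq \<bullet> (y - fst zq))" for y
      by (intro continuous_intros continuous_on_compose2[OF g]) auto
    have "closed {zq \<in> K \<times> cball 0 (real m). g y \<le> g (fst zq) + snd zq \<bullet> (y - fst zq)}" for y
      by (rule continuous_on_closed_Collect_le[OF _ cont])
         (auto intro: compact_imp_closed KC)
    then have "closed (\<Inter>y\<in>K. {zq \<in> K \<times> cball 0 (real m). g y \<le> g (fst zq) + snd zq \<bullet> (y - fst zq)})"
      by blast
    moreover have "P m = (K \<times> cball 0 (real m)) \<inter>
        (\<Inter>y\<in>K. {zq \<in> K \<times> cball 0 (real m). g y \<le> g (fst zq) + snd zq \<bullet> (y - fst zq)})"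
      unfolding P_def touching_slope_def by auto
    ultimately show ?thesis
      using compact_Int_closed[OF KC] by simp
  qed
  then have "compact (fst ` P m)" for m
    by (intro compact_continuous_image continuous_intros)
  then have "fst ` P m \<in> sets borel" for m
    by (intro borel_compact)
  moreover have "tangent_points g K = (\<Union>m. fst ` P m)"
  proof
    show "tangent_points g K \<subseteq> (\<Union>m. fst ` P m)"
    proof
      fix z assume "z \<in> tangent_points g K"
      then obtain q where q: "z \<in> K" "touching_slope g K z q"
        unfolding tangent_points_def by auto
      obtain m :: nat where "norm q \<le> real m" using real_arch_simple by blast
      with q have "(z, q) \<in> P m" unfolding P_def by auto
      then show "z \<in> (\<Union>m. fst ` P m)" by force
    qed
    show "(\<Union>m. fst ` P m) \<subseteq> tangent_points g K"
      unfolding P_def tangent_points_def by auto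
  qed
  ultimately show ?thesis by auto
qed

section \<open>Lipschitz dependence of the slope\<close>

text \<open>
  The hypothesis \<open>semi\<close> is semiconvexity at \<open>z1\<close> in second-difference form. Together with contact from
  above at \<open>z1\<close> it squeezes \<open>h y = g y - g z1 - q1 \<bullet> (y - z1)\<close> between \<open>- L * norm (y - z1)^2\<close> and \<open>0\<close>
  near \<open>z1\<close>, since \<open>h\<close> is nonpositive at the point opposite to \<open>y\<close>. Testing contact at \<open>z2\<close> one step
  of length \<open>t\<close> against the direction \<open>q2 - q1\<close> then limits \<open>norm (q2 - q1)\<close>. The step length is kept
  independent of \<open>dist z1 z2\<close> so that \<open>z1 = z2\<close> and \<open>t \<longrightarrow> 0\<close> gives uniqueness of the slope.
\<close>

lemma slope_difference_bound:
  fixes g :: "'a::euclidean_space \<Rightarrow> real"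
  assumes ball: "cball z1 r \<subseteq> K"
    and semi: "\<And>v. norm v \<le> r \<Longrightarrow> 2 * g z1 - L * (norm v)\<^sup>2 \<le> g (z1 + v) + g (z1 - v)"
    and L: "0 \<le> L"
    and q1: "touching_slope g K z1 q1" and q2: "touching_slope g K z2 q2"
    and t: "0 < t" "dist z1 z2 \<le> t" "2 * t \<le> r"
  shows "norm (q2 - q1) \<le> 4 * L * t"
proof (cases "q2 = q1")
  case True
  then show ?thesis using L t by simp
next
  case False
  define h where "h y = g y - g z1 - q1 \<bullet> (y - z1)" for y
  have h_le: "h y \<le> 0" if "y \<in> K" for y
    using q1 that unfolding touching_slope_def h_def by fastforce
  have h_ge: "- L * (norm (y - z1))\<^sup>2 \<le> h y" if y: "norm (y - z1) \<le> r" for y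
  proof -
    have "z1 - (y - z1) \<in> K"
      using ball y by (auto simp: subset_iff dist_norm)
    then have "h (z1 - (y - z1)) \<le> 0" by (rule h_le)
    then show ?thesis
      using semi[OF y] unfolding h_def by (simp add: inner_diff_right)
  qed
  define e where "e = (1 / norm (q2 - q1)) *\<^sub>R (q2 - q1)"
  define y where "y = z2 - t *\<^sub>R e"
  have e: "norm e = 1" "(q2 - q1) \<bullet> e = norm (q2 - q1)"
    using False by (auto simp: e_def dot_square_norm power2_eq_square)
  have "norm (y - z1) \<le> norm (z2 - z1) + norm (t *\<^sub>R e)"
    unfolding y_def using norm_triangle_ineq4[of "z2 - z1" "t *\<^sub>R e"] by (simp add: algebra_simps)
  also have "\<dots> \<le> 2 * t"
    using t e by (simp add: dist_norm norm_minus_commute)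
  finally have y: "norm (y - z1) \<le> 2 * t" .
  have "y \<in> K" "z2 \<in> K"
    using ball y t by (auto simp: subset_iff dist_norm norm_minus_commute)
  have "- L * (2 * t)\<^sup>2 \<le> - L * (norm (y - z1))\<^sup>2"
    using mult_left_mono[OF power_mono[OF y norm_ge_zero, of 2] L] by simp
  also have "\<dots> \<le> h y"
    using h_ge y t by simp
  also have "\<dots> \<le> h z2 + (q2 - q1) \<bullet> (y - z2)"
  proof -
    have "g y \<le> g z2 + q2 \<bullet> (y - z2)"
      using q2 \<open>y \<in> K\<close> by (simp add: touching_slope_def)
    then show ?thesis unfolding h_def by (simp add: inner_diff_right inner_diff_left)
  qed
  also have "\<dots> \<le> (q2 - q1) \<bullet> (y - z2)"
    using h_le[OF \<open>z2 \<in> K\<close>] by simp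
  also have "\<dots> = - t * norm (q2 - q1)"
    using e by (simp add: y_def)
  finally have "t * norm (q2 - q1) \<le> t * (4 * L * t)"
    by (simp add: power2_eq_square algebra_simps)
  then show ?thesis using t by simp
qed

section \<open>Slopes realised at interior points\<close>

text \<open>
  The maximiser of \<open>g y - q \<bullet> y\<close> over the closed ball has touching slope \<open>q\<close>. It cannot lie on the
  sphere: there \<open>g\<close> is below the affine function of slope \<open>p\<close> by a fixed margin \<open>m\<close>, while changing
  \<open>p\<close> to \<open>q\<close> costs at most \<open>norm (p - q) * \<rho>\<close>.
\<close>

lemma nearby_slopes_touch_inside:
  fixes g :: "'a::euclidean_space \<Rightarrow> real"
  assumes \<rho>: "0 < \<rho>" and g: "continuous_on (cball x \<rho>) g"
    and strict: "\<And>y. y \<in> sphere x \<rho> \<Longrightarrow> g y < g x + p \<bullet> (y - x)"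
  obtains \<delta> where "0 < \<delta>"
    and "\<And>q. q \<in> ball p \<delta> \<Longrightarrow> \<exists>z \<in> ball x \<rho>. touching_slope g (cball x \<rho>) z q"
proof -
  have gs: "continuous_on (sphere x \<rho>) g"
    using g by (rule continuous_on_subset) auto
  have "\<exists>s \<in> sphere x \<rho>. \<forall>y \<in> sphere x \<rho>. g x + p \<bullet> (s - x) - g s \<le> g x + p \<bullet> (y - x) - g y"
    using \<rho> by (intro continuous_attains_inf continuous_intros gs) auto
  then obtain s where s: "s \<in> sphere x \<rho>"
    and smin: "\<And>y. y \<in> sphere x \<rho> \<Longrightarrow> g x + p \<bullet> (s - x) - g s \<le> g x + p \<bullet> (y - x) - g y"
    by blast
  define m where "m = g x + p \<bullet> (s - x) - g s"
  have m: "0 < m" using strict[OF s] by (simp add: m_def)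
  show thesis
  proof
    show "0 < m / \<rho>" using m \<rho> by simp
    fix q assume q: "q \<in> ball p (m / \<rho>)"
    have "\<exists>z \<in> cball x \<rho>. \<forall>y \<in> cball x \<rho>. g y - q \<bullet> y \<le> g z - q \<bullet> z"
      using \<rho> by (intro continuous_attains_sup continuous_intros g) auto
    then obtain z where z: "z \<in> cball x \<rho>"
      and zmax: "\<And>y. y \<in> cball x \<rho> \<Longrightarrow> g y - q \<bullet> y \<le> g z - q \<bullet> z"
      by blast
    have "z \<notin> sphere x \<rho>"
    proof
      assume zs: "z \<in> sphere x \<rho>"
      have "m \<le> (p - q) \<bullet> (z - x)"
        using smin[OF zs] zmax[of x] \<rho> by (simp add: m_def inner_diff_left inner_diff_right)
      also have "\<dots> \<le> norm (p - q) * norm (z - x)" by (rule norm_cauchy_schwarz)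
      also have "\<dots> = norm (p - q) * \<rho>" using zs by (simp add: dist_norm norm_minus_commute)
      also have "\<dots> < m" using q \<rho> by (simp add: dist_norm pos_less_divide_eq)
      finally show False by simp
    qed
    then have "z \<in> ball x \<rho>" using z by auto
    moreover have "touching_slope g (cball x \<rho>) z q"
      unfolding touching_slope_def using zmax by (fastforce simp: inner_diff_right)
    ultimately show "\<exists>z \<in> ball x \<rho>. touching_slope g (cball x \<rho>) z q" by blast
  qed
qed

text \<open>
  The slope map on the interior tangent points is locally Lipschitz and its image contains a ball, so
  its domain cannot be null. Only interior points are used, since the Lipschitz estimate needs a ball
  around the contact point inside the contact region.
\<close>

lemma tangent_points_not_negligible:
  fixes g :: "'a::euclidean_space \<Rightarrow> real"
  assumes \<rho>: "0 < \<rho>" and g: "continuous_on (cball x \<rho>) g"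
    and strict: "\<And>y. y \<in> sphere x \<rho> \<Longrightarrow> g y < g x + p \<bullet> (y - x)"
    and semi: "\<And>z v. z + v \<in> cball x \<rho> \<Longrightarrow> z - v \<in> cball x \<rho> \<Longrightarrow>
                 2 * g z - L * (norm v)\<^sup>2 \<le> g (z + v) + g (z - v)"
    and L: "0 \<le> L"
  shows "\<not> negligible (tangent_points g (cball x \<rho>))"
proof
  assume neg: "negligible (tangent_points g (cball x \<rho>))"
  let ?K = "cball x \<rho>"
  obtain \<delta> where \<delta>: "0 < \<delta>"
    and ex: "\<And>q. q \<in> ball p \<delta> \<Longrightarrow> \<exists>z \<in> ball x \<rho>. touching_slope g ?K z q"
    using nearby_slopes_touch_inside[OF \<rho> g strict] by blast
  define N where "N = tangent_points g ?K \<inter> ball x \<rho>"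
  define slope where "slope z = (SOME q. touching_slope g ?K z q)" for z
  have slope: "touching_slope g ?K z (slope z)" if "z \<in> N" for z
    using that unfolding N_def tangent_points_def slope_def by (auto intro: someI)
  have room: "\<exists>r>0. cball z r \<subseteq> ?K" if "z \<in> N" for z
  proof -
    have "z \<in> ball x \<rho>" using that by (simp add: N_def)
    then show ?thesis
      using open_ball open_contains_cball ball_subset_cball subset_trans by metis
  qed
  have bound: "norm (q2 - q1) \<le> 4 * L * t"
    if "cball z r \<subseteq> ?K" "touching_slope g ?K z q1" "touching_slope g ?K z2 q2"
      "0 < t" "dist z z2 \<le> t" "2 * t \<le> r" for z z2 q1 q2 r t
  proof (rule slope_difference_bound[OF that(1) _ L that(2-6)])
    fix v :: 'a assume "norm v \<le> r"
    then have "z + v \<in> cball z r" "z - v \<in> cball z r" by (auto simp: dist_norm)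
    then show "2 * g z - L * (norm v)\<^sup>2 \<le> g (z + v) + g (z - v)"
      using that(1) by (intro semi) blast+
  qed
  \<comment> \<open>The chosen slope at \<open>z\<close> is the only one, so a slope realised at \<open>z\<close> is a value of \<open>slope\<close>.\<close>
  have unique: "slope z = q" if z: "z \<in> N" and q: "touching_slope g ?K z q" for z q
  proof -
    obtain r where r: "0 < r" "cball z r \<subseteq> ?K" using room[OF z] by blast
    have "\<forall>\<^sub>F t in at_right 0. norm (slope z - q) \<le> 4 * L * t"
      using r by (intro eventually_at_rightI[of 0 "r / 2"] bound[OF r(2) q slope[OF z]]) auto
    moreover have "((\<lambda>t. 4 * L * t) \<longlongrightarrow> 4 * L * 0) (at_right 0)"
      by (intro tendsto_intros)
    ultimately have "norm (slope z - q) \<le> 4 * L * 0"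
      using tendsto_lowerbound by (metis trivial_limit_at_right_real)
    then show ?thesis by simp
  qed
  have "negligible (slope ` N)"
  proof (rule negligible_locally_Lipschitz_image)
    show "negligible N"
      using neg negligible_subset unfolding N_def by blast
    fix z assume z: "z \<in> N"
    obtain r where r: "0 < r" "cball z r \<subseteq> ?K" using room[OF z] by blast
    have "norm (slope y - slope z) \<le> 4 * L * norm (y - z)" if y: "y \<in> N \<inter> ball z (r / 2)" for y
    proof (cases "y = z")
      case False
      then show ?thesis
        using bound[OF r(2) slope[OF z] slope[of y], of "norm (y - z)"] y
        by (simp add: dist_norm norm_minus_commute)
    qed simp
    then show "\<exists>T B. open T \<and> z \<in> T \<and> (\<forall>y\<in>N \<inter> T. norm (slope y - slope z) \<le> B * norm (y - z))"
      using r by (intro exI[of _ "ball z (r / 2)"] exI[of _ "4 * L"]) auto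
  qed simp
  moreover have "ball p \<delta> \<subseteq> slope ` N"
  proof
    fix q assume "q \<in> ball p \<delta>"
    then obtain z where z: "z \<in> ball x \<rho>" "touching_slope g ?K z q" using ex by blast
    then have "z \<in> N" by (auto simp: N_def tangent_points_def)
    then show "q \<in> slope ` N" using unique z by blast
  qed
  ultimately have "negligible (ball p \<delta>)" using negligible_subset by blast
  then show False
    using \<delta> open_not_negligible[OF open_ball, of p \<delta>] by simp
qed

section \<open>Removing the quadratic form\<close>

lemma quadratic_form_at_difference:
  fixes A :: "real ^ 'n ^ 'n"
  assumes "A \<in> sym_matrices"
  shows "(A *v (y - z)) \<bullet> (y - z) = (A *v y) \<bullet> y - (A *v z) \<bullet> z - 2 * ((A *v z) \<bullet> (y - z))"
proof -
  have "transpose A = A" using assms by (simp add: sym_matrices_def)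
  then have "(A *v y) \<bullet> z = (y v* A) \<bullet> z"
    using transpose_matrix_vector[of A y] by simp
  also have "\<dots> = (A *v z) \<bullet> y"
    unfolding dot_lmul_matrix by (rule inner_commute)
  finally have "(A *v y) \<bullet> z = (A *v z) \<bullet> y" .
  then show ?thesis
    by (simp add: matrix_vector_mult_diff_distrib inner_diff_left inner_diff_right)
qed

text \<open>Expanding the quadratic form around \<open>z\<close> changes the contact slope by \<open>A *v z\<close>.\<close>

lemma upper_contact_points_eq_tangent_points:
  fixes A :: "real ^ 'n ^ 'n"
  assumes A: "A \<in> sym_matrices"
  shows "upper_contact_points w K A = tangent_points (\<lambda>y. w y - 1 / 2 * ((A *v y) \<bullet> y)) K"
proof -
  let ?g = "\<lambda>y. w y - 1 / 2 * ((A *v y) \<bullet> y)"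
  have shift: "w y \<le> w z + q \<bullet> (y - z) + 1 / 2 * ((A *v (y - z)) \<bullet> (y - z)) \<longleftrightarrow>
      ?g y \<le> ?g z + (q - A *v z) \<bullet> (y - z)" for y z q
    unfolding quadratic_form_at_difference[OF A] inner_diff_left[of q] by argo
  have "(\<exists>q. \<forall>y\<in>K. w y \<le> w z + q \<bullet> (y - z) + 1 / 2 * ((A *v (y - z)) \<bullet> (y - z))) \<longleftrightarrow>
      (\<exists>q. touching_slope ?g K z q)" for z
    unfolding shift touching_slope_def
    by (rule iffI; elim exE) (blast, metis add_diff_cancel_right')
  then show ?thesis
    unfolding upper_contact_points_def tangent_points_def by simp
qed

lemma semiconvex_on_second_difference:
  fixes w :: "real ^ 'n \<Rightarrow> real"
  assumes w: "semiconvex_on l S w" and S: "z + v \<in> S" "z - v \<in> S"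
  shows "2 * w z - l * (norm v)\<^sup>2 \<le> w (z + v) + w (z - v)"
proof -
  have "convex_on S (\<lambda>y. w y + l / 2 * (norm y)\<^sup>2)"
    using w by (simp add: semiconvex_on_def)
  from convex_onD[OF this, of "1 / 2" "z + v" "z - v"] S
  have "2 * (w z + l / 2 * (norm z)\<^sup>2) \<le>
      w (z + v) + w (z - v) + l / 2 * ((norm (z + v))\<^sup>2 + (norm (z - v))\<^sup>2)"
    by (simp add: algebra_simps flip: scaleR_add_left)
  also have "(norm (z + v))\<^sup>2 + (norm (z - v))\<^sup>2 = 2 * (norm z)\<^sup>2 + 2 * (norm v)\<^sup>2"
    by (simp add: power2_norm_eq_inner inner_add_left inner_add_right inner_diff_left
        inner_diff_right inner_commute)
  finally show ?thesis by (simp add: algebra_simps)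
qed

lemma semiconvex_on_continuous:
  fixes w :: "real ^ 'n \<Rightarrow> real"
  assumes "open S" "semiconvex_on l S w"
  shows "continuous_on S w"
proof -
  have "continuous_on S (\<lambda>y. w y + l / 2 * (norm y)\<^sup>2)"
    using assms by (intro convex_on_continuous) (auto simp: semiconvex_on_def)
  then have "continuous_on S (\<lambda>y. (w y + l / 2 * (norm y)\<^sup>2) - l / 2 * (norm y)\<^sup>2)"
    by (rule continuous_on_diff) (intro continuous_intros)
  then show ?thesis by simp
qed

text \<open>
  The quadratic form has second difference \<open>2 * ((A *v v) \<bullet> v)\<close>, so subtracting half of it costs at
  most the operator norm of \<open>A\<close> in the semiconvexity constant.
\<close>

lemma second_difference_minus_quadratic_form:
  fixes A :: "real ^ 'n ^ 'n" and w :: "real ^ 'n \<Rightarrow> real"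
  assumes "2 * w z - l * (norm v)\<^sup>2 \<le> w (z + v) + w (z - v)"
  shows "2 * (w z - 1 / 2 * ((A *v z) \<bullet> z)) - (l + onorm ((*v) A)) * (norm v)\<^sup>2
    \<le> (w (z + v) - 1 / 2 * ((A *v (z + v)) \<bullet> (z + v))) + (w (z - v) - 1 / 2 * ((A *v (z - v)) \<bullet> (z - v)))"
proof -
  have "(A *v v) \<bullet> v \<le> norm (A *v v) * norm v" by (rule norm_cauchy_schwarz)
  also have "\<dots> \<le> (onorm ((*v) A) * norm v) * norm v"
    by (intro mult_right_mono onorm matrix_vector_mul_bounded_linear) auto
  finally have "(A *v v) \<bullet> v \<le> onorm ((*v) A) * (norm v)\<^sup>2"
    by (simp add: power2_eq_square mult.assoc)
  moreover have "(A *v (z + v)) \<bullet> (z + v) + (A *v (z - v)) \<bullet> (z - v) =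
      2 * ((A *v z) \<bullet> z) + 2 * ((A *v v) \<bullet> v)"
    by (simp add: matrix_vector_mult_diff_distrib matrix_vector_right_distrib inner_add_left
        inner_add_right inner_diff_left inner_diff_right)
  ultimately show ?thesis using assms by (simp add: algebra_simps)
qed

section \<open>Positive measure of the contact set\<close>

theorem theorem3p27:
  fixes X :: "(real ^ 'n) set" and w :: "real ^ 'n \<Rightarrow> real"
    and x p :: "real ^ 'n" and A :: "real ^ 'n ^ 'n"
  assumes "open X"
    and "locally_semiconvex_on X w"
    and "x \<in> X"
    and "A \<in> sym_matrices"
    and "strict_upper_contact_jet X w x p A"
  shows "\<exists>\<rho>'>0. cball x \<rho>' \<subseteq> X \<and>
           (\<forall>\<rho>\<in>{0<..\<rho>'}. emeasure lebesgue (upper_contact_points w (cball x \<rho>) A) > 0)"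
proof -
  obtain c r l where cr: "x \<in> ball c r" "ball c r \<subseteq> X" and l: "0 \<le> l"
    and semi: "semiconvex_on l (ball c r) w"
    using assms(2,3) unfolding locally_semiconvex_on_def by blast
  obtain r1 where r1: "0 < r1" "cball x r1 \<subseteq> ball c r"
    using cr(1) open_ball open_contains_cball by blast
  obtain d where d: "0 < d" and jet: "\<And>y. y \<in> X \<Longrightarrow> y \<noteq> x \<Longrightarrow> dist y x < d \<Longrightarrow>
      w y < w x + p \<bullet> (y - x) + 1 / 2 * ((A *v (y - x)) \<bullet> (y - x))"
    using assms(5) unfolding strict_upper_contact_jet_def eventually_at by blast
  define g where "g y = w y - 1 / 2 * ((A *v y) \<bullet> y)" for y
  define L where "L = l + onorm ((*v) A)"
  have L: "0 \<le> L"
    using l onorm_pos_le[OF matrix_vector_mul_bounded_linear[of A]] by (simp add: L_def)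
  \<comment> \<open>The radius \<open>d / 2\<close> keeps the sphere inside the open ball where the jet inequality holds.\<close>
  have pos: "emeasure lebesgue (upper_contact_points w (cball x \<rho>) A) > 0"
    if \<rho>: "0 < \<rho>" "\<rho> \<le> min r1 (d / 2)" for \<rho>
  proof -
    have sub: "cball x \<rho> \<subseteq> ball c r" using r1 \<rho> by auto
    have "continuous_on (cball x \<rho>) w"
      using semiconvex_on_continuous[OF open_ball semi] sub by (rule continuous_on_subset)
    then have g: "continuous_on (cball x \<rho>) g"
      unfolding g_def by (intro continuous_intros matrix_vector_mult_linear_continuous_on)
    have strict: "g y < g x + (p - A *v x) \<bullet> (y - x)" if "y \<in> sphere x \<rho>" for y
    proof -
      have "y \<in> X" using that sub cr(2) by auto
      moreover have "y \<noteq> x" "dist y x < d" using that \<rho> by (auto simp: dist_commute)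
      ultimately have "w y < w x + p \<bullet> (y - x) + 1 / 2 * ((A *v (y - x)) \<bullet> (y - x))"
        by (rule jet)
      then show ?thesis
        unfolding quadratic_form_at_difference[OF assms(4)] g_def inner_diff_left[of p] by argo
    qed
    have "2 * g z - L * (norm v)\<^sup>2 \<le> g (z + v) + g (z - v)"
      if "z + v \<in> cball x \<rho>" "z - v \<in> cball x \<rho>" for z v
      unfolding g_def L_def
      using that sub
      by (intro second_difference_minus_quadratic_form semiconvex_on_second_difference[OF semi]) auto
    then have "\<not> negligible (tangent_points g (cball x \<rho>))"
      using tangent_points_not_negligible[OF \<rho>(1) g strict _ L] by blast
    moreover have "tangent_points g (cball x \<rho>) \<in> sets lebesgue"
      using tangent_points_borel[OF compact_cball g] by (simp add: sets_completionI_sets)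
    ultimately have "emeasure lebesgue (tangent_points g (cball x \<rho>)) \<noteq> 0"
      by (auto simp: negligible_iff_null_sets)
    then show ?thesis
      unfolding upper_contact_points_eq_tangent_points[OF assms(4)] g_def
      by (simp add: zero_less_iff_neq_zero)
  qed
  have "cball x (min r1 (d / 2)) \<subseteq> X"
    using r1(2) cr(2) by (auto simp: subset_iff)
  then show ?thesis
    using pos r1(1) d by (intro exI[of _ "min r1 (d / 2)"]) auto
qed

end
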